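(* Let $G_t$ be the group generated by the two linear transformations $s_1,s_2$ of $\mathbb{C}^6$ defined in the context. Then $G_t$ is isomorphic to $W(C_2)$, the Weyl group associated to the root system $C_2$.
   Context: Write vectors of $\mathbb{C}^6$ as ${}^t[b,a,c,d,e_1,e_2]$. The transformation $s_1$ sends $(b,a,c,d,e_1,e_2)$ to $(b,\ e_1-a,\ e_1-c,\ e_1+e_2-a-c,\ e_1,\ d+e_1-a-c)$, and $s_2$ exchanges $e_1$ and $e_2$ and fixes the other coordinates. (These are the parameter symmetries of the $A_n$ terminating balanced ${}_4F_3$ series of triangular type.) The group operation is composition. *)

theory Defs
  imports "HOL-Analysis.Analysis" "HOL-Algebra.Elementary_Groups"
begin

definition GL :: "('a::field ^ 'n \<Rightarrow> 'a ^ 'n) monoid"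
  where "GL = \<lparr>carrier = {f. Vector_Spaces.linear (*s) (*s) f \<and> bij f}, mult = (\<circ>), one = id\<rparr>"

lemma group_GL: "group (GL :: ('a::field ^ 'n \<Rightarrow> 'a ^ 'n) monoid)"
proof (rule groupI)
  fix f :: "'a ^ 'n \<Rightarrow> 'a ^ 'n"
  assume "f \<in> carrier GL"
  then have lin: "Vector_Spaces.linear (*s) (*s) f" and bij: "bij f"
    by (auto simp: GL_def)
  let ?g = "inv_into UNIV f"
  have gf: "?g (f x) = x" and fg: "f (?g x) = x" for x
    using bij by (simp_all add: bij_is_inj bij_is_surj surj_f_inv_f)
  have add: "f (x + y) = f x + f y" and scale: "f (r *s x) = r *s f x" for r x y
    using lin by (auto simp: Vector_Spaces.linear_iff)
  have "?g (x + y) = ?g x + ?g y" for x y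
    using gf[of "?g x + ?g y"] by (simp add: add fg)
  moreover have "?g (r *s x) = r *s ?g x" for r x
    using gf[of "r *s ?g x"] by (simp add: scale fg)
  ultimately have "Vector_Spaces.linear (*s) (*s) ?g"
    by (simp add: Vector_Spaces.linear_iff vec.vector_space_axioms)
  then have "?g \<in> carrier GL"
    using bij by (simp add: GL_def bij_imp_bij_inv)
  moreover have "?g \<otimes>\<^bsub>GL\<^esub> f = \<one>\<^bsub>GL\<^esub>"
    by (simp add: GL_def fun_eq_iff gf)
  ultimately show "\<exists>g\<in>carrier GL. g \<otimes>\<^bsub>GL\<^esub> f = \<one>\<^bsub>GL\<^esub>"
    by blast
qed (simp_all add: GL_def comp_assoc bij_comp Vector_Spaces.linear_iff vec.vector_space_axioms)

text \<open>
  The coordinates \<open>b, a, c, d, e\<^sub>1, e\<^sub>2\<close> are the components \<open>$ 1, \<dots>, $ 6\<close>, in this order.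
\<close>

definition s1 :: "complex ^ 6 \<Rightarrow> complex ^ 6"
  where "s1 v = (let b = v $ 1; a = v $ 2; c = v $ 3; d = v $ 4; e1 = v $ 5; e2 = v $ 6 in
    vector [b, e1 - a, e1 - c, e1 + e2 - a - c, e1, d + e1 - a - c])"

definition s2 :: "complex ^ 6 \<Rightarrow> complex ^ 6"
  where "s2 v = (let b = v $ 1; a = v $ 2; c = v $ 3; d = v $ 4; e1 = v $ 5; e2 = v $ 6 in
    vector [b, a, c, d, e2, e1])"

lemma exhaust_6: "x = 1 \<or> x = 2 \<or> x = 3 \<or> x = 4 \<or> x = 5 \<or> x = 6" for x :: 6
proof (induct x)
  case (of_int z)
  then have "z = 0 \<or> z = 1 \<or> z = 2 \<or> z = 3 \<or> z = 4 \<or> z = 5" by auto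
  then show ?case by auto
qed

lemma vec_eq_6:
  "(v :: 'a ^ 6) = w \<longleftrightarrow> v $ 1 = w $ 1 \<and> v $ 2 = w $ 2 \<and> v $ 3 = w $ 3 \<and>
    v $ 4 = w $ 4 \<and> v $ 5 = w $ 5 \<and> v $ 6 = w $ 6" (is "_ \<longleftrightarrow> ?R")
proof
  assume ?R
  then have "v $ i = w $ i" for i
    using exhaust_6[of i] by (elim disjE) simp_all
  then show "v = w" by (simp add: vec_eq_iff)
qed simp

lemma vector_6 [simp]:
  "(vector [x1, x2, x3, x4, x5, x6] :: 'a::zero ^ 6) $ 1 = x1"
  "(vector [x1, x2, x3, x4, x5, x6] :: 'a::zero ^ 6) $ 2 = x2"
  "(vector [x1, x2, x3, x4, x5, x6] :: 'a::zero ^ 6) $ 3 = x3"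
  "(vector [x1, x2, x3, x4, x5, x6] :: 'a::zero ^ 6) $ 4 = x4"
  "(vector [x1, x2, x3, x4, x5, x6] :: 'a::zero ^ 6) $ 5 = x5"
  "(vector [x1, x2, x3, x4, x5, x6] :: 'a::zero ^ 6) $ 6 = x6"
  by (simp_all add: vector_def)

text \<open>
  \<^const>\<open>subgroup_generated\<close> discards generators outside the carrier; the next lemma shows that
  neither \<^const>\<open>s1\<close> nor \<^const>\<open>s2\<close> is lost.
\<close>

lemma s1_s2_in_GL: "s1 \<in> carrier GL" "s2 \<in> carrier GL"
proof -
  have "s1 (s1 v) = v" "s2 (s2 v) = v" for v
    by (simp_all add: s1_def s2_def Let_def vec_eq_6)
  then have "bij s1" "bij s2"
    by (simp_all add: involuntory_imp_bij)
  then show "s1 \<in> carrier GL" "s2 \<in> carrier GL"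
    by (simp_all add: GL_def Vector_Spaces.linear_iff vec.vector_space_axioms
        s1_def s2_def Let_def vec_eq_6 algebra_simps)
qed

definition Gt :: "(complex ^ 6 \<Rightarrow> complex ^ 6) monoid"
  where "Gt = subgroup_generated GL {s1, s2}"

definition root_reflection :: "real ^ 'n \<Rightarrow> real ^ 'n \<Rightarrow> real ^ 'n"
  where "root_reflection \<alpha> x = x - (2 * (x \<bullet> \<alpha>) / (\<alpha> \<bullet> \<alpha>)) *\<^sub>R \<alpha>"

lemma root_reflection_in_GL: "root_reflection \<alpha> \<in> carrier GL"
proof -
  have "root_reflection \<alpha> (root_reflection \<alpha> x) = x" for x
  proof (cases "\<alpha> = 0")
    case False
    then have "root_reflection \<alpha> x \<bullet> \<alpha> = - (x \<bullet> \<alpha>)"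
      by (simp add: root_reflection_def inner_diff_left)
    then show ?thesis
      by (simp add: root_reflection_def[of \<alpha> "root_reflection \<alpha> x"])
         (simp add: root_reflection_def)
  qed (simp add: root_reflection_def)
  then have "bij (root_reflection \<alpha>)"
    by (rule involuntory_imp_bij)
  moreover have "root_reflection \<alpha> (x + y) = root_reflection \<alpha> x + root_reflection \<alpha> y" for x y
    by (simp add: root_reflection_def inner_add_left distrib_left add_divide_distrib
        scaleR_add_left)
  moreover have "root_reflection \<alpha> (r *s x) = r *s root_reflection \<alpha> x" for r x
    by (simp add: root_reflection_def scalar_mult_eq_scaleR scaleR_diff_right mult.left_commute)
  ultimately show ?thesis
    by (simp add: GL_def Vector_Spaces.linear_iff vec.vector_space_axioms)
qed

definition weyl_group :: "(real ^ 'n) set \<Rightarrow> (real ^ 'n \<Rightarrow> real ^ 'n) monoid"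
  where "weyl_group \<Phi> = subgroup_generated GL (root_reflection ` \<Phi>)"

text \<open>
  The root system of type \<open>C\<^sub>n\<close> with \<open>n = CARD('n)\<close>: the short roots \<open>\<plusminus>\<epsilon>\<^sub>i \<plusminus> \<epsilon>\<^sub>j\<close> (\<open>i \<noteq> j\<close>, all
  choices of signs) and the long roots \<open>\<plusminus>2\<epsilon>\<^sub>i\<close>, where \<open>\<epsilon>\<^sub>i\<close> is the standard basis.
\<close>

definition root_system_C :: "(real ^ 'n) set"
  where "root_system_C =
    {s *\<^sub>R axis i 1 + t *\<^sub>R axis j 1 | s t i j. s \<in> {1, -1} \<and> t \<in> {1, -1} \<and> i \<noteq> j} \<union>
    {s *\<^sub>R axis i 2 | s i. s \<in> {1, -1}}"

end

theory Submission
  imports Defs "HOL-Algebra.Multiplicative_Group"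
begin

text \<open>
  Both groups are generated by two involutions whose product has order four, and this determines
  a group up to isomorphism: it is the dihedral group of order eight.

  Let \<open>x\<close> and \<open>y\<close> be involutions in a group and \<open>r = xy\<close>. Conjugation by \<open>y\<close> inverts \<open>r\<close>, because
  \<open>y(xy)y = yx\<close>. Hence every element of the generated subgroup has the form \<open>r\<^sup>i\<close> or \<open>r\<^sup>i y\<close>, and
  such normal forms are multiplied by a rule that does not mention the group
  (\<open>normal_form_mult\<close>). If \<open>r\<^sup>2 \<noteq> 1\<close>, then \<open>y\<close> is not a power of \<open>r\<close>, since it does not commute with
  \<open>r\<close>; so two normal forms are equal only if they agree in the factor \<open>y\<close> and their exponents
  differ by a multiple of the order of \<open>r\<close> (\<open>normal_form_eq_iff\<close>). Thus the order of \<open>r\<close>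
  determines the group (\<open>iso_of_ord_eq\<close>).

  For \<open>Gt\<close> the two involutions are given, and the order of their product is found by evaluating it
  on coordinates. The Weyl group of \<open>C\<^sub>2\<close> is generated by the reflections in the two simple roots
  \<open>\<epsilon>\<^sub>1 - \<epsilon>\<^sub>2\<close> and \<open>2\<epsilon>\<^sub>2\<close>, whose product is a rotation of the plane by a right angle.
\<close>

section \<open>Groups generated by two involutions\<close>

locale involution_pair = group G for G (structure) +
  fixes x y
  assumes x_closed [simp]: "x \<in> carrier G" and y_closed [simp]: "y \<in> carrier G"
    and xx: "x \<otimes> x = \<one>" and yy: "y \<otimes> y = \<one>"
    and rr: "(x \<otimes> y) \<otimes> (x \<otimes> y) \<noteq> \<one>"
begin

definition r where "r = x \<otimes> y"

text \<open>
  The exponent of \<open>y\<close> is recorded as a truth value, so that exponents of \<open>y\<close> add up by \<open>\<noteq>\<close>.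
\<close>

definition normal_form :: "int \<times> bool \<Rightarrow> 'a"
  where "normal_form p = r [^] fst p \<otimes> (if snd p then y else \<one>)"

lemma r_closed [simp]: "r \<in> carrier G"
  by (simp add: r_def)

lemma normal_form_closed [simp]: "normal_form p \<in> carrier G"
  by (simp add: normal_form_def)

lemma y_mult_y_mult [simp]: "g \<in> carrier G \<Longrightarrow> y \<otimes> (y \<otimes> g) = g"
  by (simp add: yy flip: m_assoc)

lemma conj_r: "y \<otimes> r \<otimes> y = inv r"
proof (rule inv_equality[symmetric])
  have "y \<otimes> r \<otimes> y \<otimes> r = y \<otimes> (x \<otimes> (y \<otimes> (y \<otimes> (x \<otimes> y))))"
    by (simp add: r_def m_assoc)
  also have "\<dots> = y \<otimes> (x \<otimes> x \<otimes> y)"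
    by (simp add: m_assoc)
  finally show "y \<otimes> r \<otimes> y \<otimes> r = \<one>"
    by (simp add: xx yy)
qed simp_all

lemma y_mult_r_pow: "y \<otimes> r [^] i = r [^] (- i) \<otimes> y" for i :: int
proof -
  have "(\<lambda>g. y \<otimes> g \<otimes> y) \<in> hom G G"
    by (rule homI) (simp_all add: m_assoc)
  then have "y \<otimes> r [^] i \<otimes> y = inv r [^] i"
    using hom_int_pow[of "\<lambda>g. y \<otimes> g \<otimes> y" G G r i] conj_r is_group by simp
  then have "y \<otimes> r [^] i \<otimes> y \<otimes> y = r [^] (- i) \<otimes> y"
    by (simp add: int_pow_inv int_pow_neg)
  then show ?thesis
    by (simp add: m_assoc yy)
qed

lemma normal_form_mult:
  "normal_form (i, j) \<otimes> normal_form (k, l) = normal_form (i + (if j then - k else k), j \<noteq> l)"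
proof -
  have "y \<otimes> (r [^] k \<otimes> g) = r [^] (- k) \<otimes> (y \<otimes> g)" if "g \<in> carrier G" for g
    using that y_mult_r_pow[of k] by (simp flip: m_assoc)
  then show ?thesis
    by (simp add: normal_form_def m_assoc int_pow_mult yy y_mult_r_pow)
qed

text \<open>
  The condition \<open>r\<^sup>2 \<noteq> 1\<close> rules out that \<open>y\<close> centralises \<open>r\<close>, as powers of \<open>r\<close> do. In
  the excluded case \<open>x = 1\<close>, for example, \<open>r = y\<close> and normal forms are not unique.
\<close>

lemma y_neq_r_pow: "y \<noteq> r [^] i" for i :: int
proof
  assume y: "y = r [^] i"
  have "r [^] i \<otimes> r = r \<otimes> r [^] i"
    by (metis add.commute int_pow_1 int_pow_mult r_closed)
  then have "y \<otimes> r = r \<otimes> y"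
    by (simp only: y[symmetric])
  then have "r = inv r"
    using conj_r by (simp add: m_assoc yy)
  then have "r \<otimes> r = \<one>"
    by (metis r_closed r_inv)
  then show False
    using rr by (simp add: r_def)
qed

lemma normal_form_eq_iff:
  "normal_form (i, j) = normal_form (k, l) \<longleftrightarrow> j = l \<and> int (ord r) dvd k - i"
proof -
  have ne: "r [^] m \<otimes> y \<noteq> r [^] n" for m n :: int
  proof
    assume "r [^] m \<otimes> y = r [^] n"
    then have "y = r [^] (- m) \<otimes> r [^] n"
      by (metis int_pow_closed int_pow_neg inv_solve_left r_closed y_closed)
    then show False
      using y_neq_r_pow[of "- m + n"] int_pow_mult[OF r_closed, of "- m" n] by metis
  qed
  show ?thesis
    using ne[of i k] ne[of k i]
    by (cases j; cases l) (auto simp: normal_form_def int_pow_eq)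
qed

lemma range_normal_form: "carrier (subgroup_generated G {x, y}) = range normal_form"
proof
  have one: "\<one> = normal_form (0, False)"
    by (simp add: normal_form_def)
  have y: "y = normal_form (0, True)"
    by (simp add: normal_form_def)
  have x: "x = normal_form (1, True)"
    by (simp add: normal_form_def r_def m_assoc yy)
  have "subgroup (range normal_form) G"
  proof (rule subgroupI)
    fix a assume "a \<in> range normal_form"
    then obtain i j where a: "a = normal_form (i, j)" by auto
    have "normal_form ((if j then i else - i), j) \<otimes> a = \<one>"
      by (simp add: a one normal_form_mult)
    then have "inv a = normal_form ((if j then i else - i), j)"
      by (rule inv_equality) (simp_all add: a)
    then show "inv a \<in> range normal_form" by simp
  qed (auto simp: normal_form_mult)
  moreover have "{x, y} \<subseteq> range normal_form"
    using x y by blast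
  ultimately show "carrier (subgroup_generated G {x, y}) \<subseteq> range normal_form"
    by (rule subgroup_generated_minimal)
next
  let ?K = "carrier (subgroup_generated G {x, y})"
  have K: "subgroup ?K G"
    by (rule subgroup_subgroup_generated)
  have xy: "x \<in> ?K" "y \<in> ?K"
    using subgroup_generated_subset_carrier_subset[of "{x, y}"] by auto
  then have "r \<in> ?K"
    unfolding r_def by (intro subgroup.m_closed[OF K])
  then have "r [^] i \<in> ?K" for i :: int
    by (rule subgroup_int_pow_closed[OF K])
  then show "range normal_form \<subseteq> ?K"
    using xy subgroup.m_closed[OF K] subgroup.one_closed[OF K]
    by (auto simp: normal_form_def)
qed

lemma ord_r_eq_4:
  assumes "(r \<otimes> r) \<otimes> (r \<otimes> r) = \<one>"
  shows "ord r = 4"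
proof -
  have "r [^] (4::nat) = \<one>" "r [^] (2::nat) \<noteq> \<one>"
    using assms rr by (simp_all add: numeral_eq_Suc m_assoc r_def[symmetric])
  then have dvd: "ord r dvd 4" "\<not> ord r dvd 2"
    by (simp_all add: pow_eq_id)
  then have "ord r \<le> 4"
    by (simp add: dvd_imp_le)
  then have "ord r \<in> {0, 1, 2, 3, 4}"
    by auto
  then show ?thesis
    using dvd by auto
qed

end

text \<open>
  The isomorphism matches normal forms. Equality of the orders makes it well defined and injective,
  and it is multiplicative because the multiplication rule is the same in both groups.
\<close>

lemma iso_of_ord_eq:
  assumes "involution_pair G x y" and "involution_pair H x' y'"
    and ord: "group.ord G (x \<otimes>\<^bsub>G\<^esub> y) = group.ord H (x' \<otimes>\<^bsub>H\<^esub> y')"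
  shows "subgroup_generated G {x, y} \<cong> subgroup_generated H {x', y'}"
proof -
  interpret G: involution_pair G x y by fact
  interpret H: involution_pair H x' y' by fact
  define \<phi> where "\<phi> g = H.normal_form (SOME p. G.normal_form p = g)" for g
  have same: "G.normal_form p = G.normal_form q \<longleftrightarrow> H.normal_form p = H.normal_form q" for p q
    using ord by (cases p; cases q)
      (simp add: G.normal_form_eq_iff H.normal_form_eq_iff G.r_def H.r_def)
  have \<phi>: "\<phi> (G.normal_form p) = H.normal_form p" for p
    unfolding \<phi>_def same[symmetric] by (rule someI) (rule refl)
  have "\<phi> \<in> iso (subgroup_generated G {x, y}) (subgroup_generated H {x', y'})"
  proof (rule isoI)
    show "\<phi> \<in> hom (subgroup_generated G {x, y}) (subgroup_generated H {x', y'})"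
      by (rule homI)
        (auto simp: G.range_normal_form H.range_normal_form \<phi> G.normal_form_mult H.normal_form_mult)
    show "bij_betw \<phi> (carrier (subgroup_generated G {x, y}))
        (carrier (subgroup_generated H {x', y'}))"
      unfolding G.range_normal_form H.range_normal_form
      by (auto simp: bij_betw_def inj_on_def \<phi> same image_image)
  qed
  then show ?thesis
    by (rule is_isoI)
qed

section \<open>The group of parameter symmetries\<close>

lemma GL_simps: "f \<otimes>\<^bsub>GL\<^esub> g = f \<circ> g" "\<one>\<^bsub>GL\<^esub> = id"
  by (simp_all add: GL_def)

lemma involution_pair_s1_s2: "involution_pair GL s1 s2"
proof (intro involution_pair.intro involution_pair_axioms.intro)
  \<comment> \<open>The square of the product sends \<open>a\<close> to \<open>d - c\<close>, so the unit vector with \<open>c = 1\<close> is moved.\<close>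
  have "(s1 \<circ> s2 \<circ> (s1 \<circ> s2)) (axis 3 1) \<noteq> id (axis 3 1)"
    by (simp add: s1_def s2_def Let_def vec_eq_6 axis_def)
  then show "s1 \<otimes>\<^bsub>GL\<^esub> s2 \<otimes>\<^bsub>GL\<^esub> (s1 \<otimes>\<^bsub>GL\<^esub> s2) \<noteq> \<one>\<^bsub>GL\<^esub>"
    unfolding GL_simps by force
qed (simp_all add: group_GL s1_s2_in_GL,
    simp_all add: GL_simps fun_eq_iff s1_def s2_def Let_def vec_eq_6)

lemma ord_s1_s2: "group.ord GL (s1 \<otimes>\<^bsub>GL\<^esub> s2) = 4"
proof -
  interpret involution_pair GL s1 s2 by (rule involution_pair_s1_s2)
  have "ord r = 4"
    by (rule ord_r_eq_4)
      (simp add: r_def GL_simps fun_eq_iff s1_def s2_def Let_def vec_eq_6 algebra_simps)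
  then show ?thesis
    by (simp add: r_def)
qed

section \<open>The Weyl group of type \<open>C\<^sub>2\<close>\<close>

abbreviation (input) simple_short :: "real ^ 2 \<Rightarrow> real ^ 2"
  where "simple_short \<equiv> root_reflection (axis 1 1 - axis 2 1)"

abbreviation (input) simple_long :: "real ^ 2 \<Rightarrow> real ^ 2"
  where "simple_long \<equiv> root_reflection (axis 2 2)"

lemma simple_short_eq: "simple_short v = vector [v $ 2, v $ 1]"
  by (simp add: root_reflection_def vec_eq_iff forall_2 inner_vec_def sum_2 axis_def field_simps)

lemma simple_long_eq: "simple_long v = vector [v $ 1, - v $ 2]"
  by (simp add: root_reflection_def vec_eq_iff forall_2 inner_vec_def sum_2 axis_def field_simps)

lemma exists_2: "(\<exists>i::2. P i) \<longleftrightarrow> P 1 \<or> P 2"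
  by (metis exhaust_2)

lemma root_reflection_minus: "root_reflection (- \<alpha>) = root_reflection \<alpha>"
  by (simp add: root_reflection_def fun_eq_iff)

lemma root_reflection_sum:
  "root_reflection (axis 1 1 + axis 2 1) = simple_long \<circ> simple_short \<circ> simple_long"
  by (simp add: fun_eq_iff simple_short_eq simple_long_eq)
     (simp add: root_reflection_def vec_eq_iff forall_2 inner_vec_def sum_2 axis_def field_simps)

lemma root_reflection_first_long:
  "root_reflection (axis 1 2) = simple_short \<circ> simple_long \<circ> simple_short"
  by (simp add: fun_eq_iff simple_short_eq simple_long_eq)
     (simp add: root_reflection_def vec_eq_iff forall_2 inner_vec_def sum_2 axis_def field_simps)

text \<open>
  Opposite roots have the same reflection, so there are four reflections; the two that are not
  simple are conjugates of a simple one by the other.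
\<close>

lemma root_reflections_C2:
  "root_reflection ` (root_system_C :: (real ^ 2) set) =
    {simple_short, simple_long, simple_long \<circ> simple_short \<circ> simple_long,
     simple_short \<circ> simple_long \<circ> simple_short}"
proof -
  let ?short = "axis 1 1 - axis 2 1 :: real ^ 2" and ?sum = "axis 1 1 + axis 2 1 :: real ^ 2"
  let ?roots = "{?short, - ?short, ?sum, - ?sum, axis 1 2, - axis 1 2, axis 2 2, - axis 2 2}"
  have "v \<in> root_system_C \<longleftrightarrow> v \<in> ?roots" for v :: "real ^ 2"
    by (simp add: root_system_C_def exists_2 ex_disj_distrib conj_disj_distribL conj_disj_distribR,
        simp add: add.commute minus_diff_commute, blast)
  then have roots: "root_system_C = ?roots"
    by blast
  show ?thesis
    unfolding roots
    by (simp only: image_insert image_empty root_reflection_minus root_reflection_sum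
        root_reflection_first_long insert_absorb2) blast
qed

lemma weyl_group_C2:
  "weyl_group root_system_C = subgroup_generated GL {simple_short, simple_long}"
proof -
  interpret group "GL :: (real ^ 2 \<Rightarrow> real ^ 2) monoid" by (rule group_GL)
  let ?R = "root_reflection ` (root_system_C :: (real ^ 2) set)"
    and ?S = "{simple_short, simple_long}"
  let ?K = "carrier (subgroup_generated GL ?S)"
  have S: "?S \<subseteq> ?K"
    by (rule subgroup_generated_subset_carrier_subset) (simp add: root_reflection_in_GL)
  have comp: "f \<circ> g \<in> ?K" if "f \<in> ?K" "g \<in> ?K" for f g
    using subgroup.m_closed[OF subgroup_subgroup_generated that] by (simp add: GL_def)
  have "?R \<subseteq> ?K"
    unfolding root_reflections_C2 using S by (simp add: comp)
  then have "carrier (subgroup_generated GL ?R) \<subseteq> ?K"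
    by (rule subgroup_generated_minimal[OF subgroup_subgroup_generated])
  moreover have "?K \<subseteq> carrier (subgroup_generated GL ?R)"
    unfolding carrier_subgroup_generated root_reflections_C2 by (rule mono_generate) blast
  ultimately show ?thesis
    unfolding weyl_group_def subgroup_generated_def by simp
qed

lemma involution_pair_simple: "involution_pair GL simple_short simple_long"
proof (intro involution_pair.intro involution_pair_axioms.intro)
  let ?f = "simple_short \<circ> simple_long"
  have "(?f \<circ> ?f) (axis 1 1) \<noteq> id (axis 1 1)"
    by (simp add: simple_short_eq simple_long_eq vec_eq_iff forall_2)
  then show "simple_short \<otimes>\<^bsub>GL\<^esub> simple_long \<otimes>\<^bsub>GL\<^esub> (simple_short \<otimes>\<^bsub>GL\<^esub> simple_long) \<noteq> \<one>\<^bsub>GL\<^esub>"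
    unfolding GL_simps by force
qed (simp_all add: group_GL root_reflection_in_GL,
    simp_all add: GL_simps fun_eq_iff simple_short_eq simple_long_eq vec_eq_iff forall_2)

lemma ord_simple: "group.ord GL (simple_short \<otimes>\<^bsub>GL\<^esub> simple_long) = 4"
proof -
  interpret involution_pair GL simple_short simple_long by (rule involution_pair_simple)
  have "ord r = 4"
    by (rule ord_r_eq_4)
      (simp add: r_def GL_simps fun_eq_iff simple_short_eq simple_long_eq vec_eq_iff forall_2)
  then show ?thesis
    by (simp add: r_def)
qed

theorem mainTheorem4:
  shows "Gt \<cong> weyl_group (root_system_C :: (real ^ 2) set)"
  unfolding Gt_def weyl_group_C2
  by (rule iso_of_ord_eq[OF involution_pair_s1_s2 involution_pair_simple])
    (simp add: ord_s1_s2 ord_simple)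

end
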